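(* Let $n\ge 1$ be an integer and suppose that the smooth function $u=u(x_1,\dots,x_n):\mathbb{R}^n\to\mathbb{R}$ satisfies the self-shrinker equation $$\operatorname{div}\left(\frac{Du}{\sqrt{1+|Du|^2}}\right)=\frac{x_1u_{x_1}+\dots+x_nu_{x_n}-u}{2\sqrt{1+|Du|^2}}$$ on all of $\mathbb{R}^n$, where $Du=(u_{x_1},\dots,u_{x_n})$ and $|Du|^2=u_{x_1}^2+\dots+u_{x_n}^2$. Then there are constants $a_1,\dots,a_n\in\mathbb{R}$ such that $u(x_1,\dots,x_n)=a_1x_1+\dots+a_nx_n$ for all $(x_1,\dots,x_n)\in\mathbb{R}^n$.
   Context: Subscripts $x_1,\dots,x_n$ denote partial derivatives, and $\operatorname{div}$ is the Euclidean divergence on $\mathbb{R}^n$. *)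

theory Defs
  imports "HOL-Analysis.Analysis"
begin

definition partial_deriv :: "'n \<Rightarrow> (real ^ 'n \<Rightarrow> real) \<Rightarrow> real ^ 'n::finite \<Rightarrow> real" where
  "partial_deriv i f x = deriv (\<lambda>t. f (x + t *\<^sub>R axis i 1)) 0"

(* The differentiability conjunct matters: deriv is an unspecified value where no derivative
   exists. Differentiability with continuous partial derivatives is the same as existence and
   continuity of the partial derivatives. *)
primrec C_k :: "nat \<Rightarrow> (real ^ 'n::finite \<Rightarrow> real) \<Rightarrow> bool" where
  "C_k 0 f \<longleftrightarrow> continuous_on UNIV f"
| "C_k (Suc k) f \<longleftrightarrow> f differentiable_on UNIV \<and> (\<forall>i. C_k k (partial_deriv i f))"

definition smooth :: "(real ^ 'n::finite \<Rightarrow> real) \<Rightarrow> bool" where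
  "smooth f \<longleftrightarrow> (\<forall>k. C_k k f)"

definition gradient :: "(real ^ 'n \<Rightarrow> real) \<Rightarrow> real ^ 'n::finite \<Rightarrow> real ^ 'n" where
  "gradient f x = (\<chi> i. partial_deriv i f x)"

definition divergence :: "(real ^ 'n \<Rightarrow> real ^ 'n) \<Rightarrow> real ^ 'n::finite \<Rightarrow> real" where
  "divergence X x = (\<Sum>i\<in>UNIV. partial_deriv i (\<lambda>y. X y $ i) x)"

end

theory Submission
  imports Defs
begin

text \<open>Write \<open>W = sqrt (1 + |Du|\<^sup>2)\<close> for the area element of the graph, \<open>N = Du / W\<close>, and
  \<open>f = (|x|\<^sup>2 + u\<^sup>2) / 4\<close> for a quarter of the squared distance of the graph point \<open>(x, u x)\<close>
  from the origin. The equation says \<open>div N = H\<close> with \<open>H = (x \<bullet> Du - u) / (2 W)\<close>, that is, the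
  graph is critical for the Gaussian area \<open>\<integral> W exp (-f)\<close>. The plan is a Liouville argument for the
  first derivatives of \<open>u\<close>.

  Let \<open>v = u\<^sub>k\<close>. Differentiating \<open>div N = H\<close> along the \<open>k\<close>-th axis, the undifferentiated \<open>v\<close> cancels,
  because the derivative of \<open>x \<bullet> Du - u\<close> is \<open>x \<bullet> Dv\<close>. What is left is the homogeneous
  equation \<open>div (exp (-f) \<partial>\<^sub>k N) = 0\<close>, where \<open>\<partial>\<^sub>k N = (Dv - (N \<bullet> Dv) N) / W\<close>
  is a positive definite matrix applied to \<open>Dv\<close>
  (lemma \<open>divergence_dN\<close>). Testing it with \<open>v\<close> times a squared cutoff at scale \<open>f \<approx> S\<close>, and using
  \<open>|v| \<le> W\<close>, bounds the cut-off energy of \<open>v\<close> by \<open>16 / S\<close> times the Gaussian area of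
  \<open>f \<le> 2 S\<close> (lemma \<open>energy_bound\<close>).

  So it suffices that the Gaussian area is finite. This holds because the graph is entire: the
  sublevel sets of \<open>f\<close> are compact. A suitable multiple of the tangential part of the position
  vector has weighted divergence \<open>(n - 2 f) W exp (-f)\<close>, and its flux through a level set of \<open>f\<close>
  points outwards. Hence \<open>f\<close> has mean at most \<open>n / 2\<close> over each sublevel set, which
  leaves at most half of the area to the region \<open>f > n\<close>, uniformly in the sublevel set (lemma
  \<open>weighted_area_bound\<close>, where cutoffs replace the sublevel sets).

  Letting \<open>S\<close> tend to infinity gives \<open>Dv = 0\<close> for every \<open>k\<close>. So \<open>u\<close> is affine, and the equation at
  the origin reads \<open>0 = - u 0 / (2 W)\<close>.\<close>

section \<open>Calculus with partial derivatives\<close>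

lemma has_derivative_along_axis:
  fixes f :: "real ^ 'n::finite \<Rightarrow> real"
  assumes "(f has_derivative f') (at (x + s *\<^sub>R axis i 1))"
  shows "((\<lambda>t. f (x + t *\<^sub>R axis i 1)) has_real_derivative f' (axis i 1)) (at s)"
proof -
  have "((\<lambda>t. f (x + t *\<^sub>R axis i 1)) has_derivative (\<lambda>t. f' (t *\<^sub>R axis i 1))) (at s)"
    by (rule has_derivative_compose[where f = "\<lambda>t. x + t *\<^sub>R axis i 1", OF _ assms])
      (auto intro!: derivative_eq_intros)
  moreover have "(\<lambda>t. f' (t *\<^sub>R axis i 1)) = (*) (f' (axis i 1))"
    using has_derivative_linear[OF assms] by (auto simp: linear_cmul)
  ultimately show ?thesis by (simp add: has_field_derivative_def)
qed

lemma partial_deriv_eq: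
  assumes "(f has_derivative f') (at x)"
  shows "partial_deriv i f x = f' (axis i 1)"
  using has_derivative_along_axis[of f f' x 0 i] assms
  by (simp add: partial_deriv_def DERIV_imp_deriv)

lemma has_derivative_gradient:
  assumes "f differentiable (at x)"
  shows "(f has_derivative (\<lambda>h. gradient f x \<bullet> h)) (at x)"
proof -
  obtain f' where f': "(f has_derivative f') (at x)"
    using assms by (auto simp: differentiable_def)
  have lin: "linear f'" using f' by (rule has_derivative_linear)
  have "f' h = gradient f x \<bullet> h" for h
  proof -
    have "f' h = f' (\<Sum>i\<in>UNIV. h $ i *\<^sub>R axis i 1)"
      using basis_expansion[of h] by (simp add: scalar_mult_eq_scaleR)
    also have "\<dots> = (\<Sum>i\<in>UNIV. h $ i * f' (axis i 1))"
      using lin by (simp add: linear_sum linear_cmul)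
    also have "\<dots> = gradient f x \<bullet> h"
      by (simp add: inner_vec_def gradient_def partial_deriv_eq[OF f'] mult.commute)
    finally show ?thesis .
  qed
  then show ?thesis using f' by presburger
qed

lemma partial_deriv_along_axis:
  assumes "f differentiable_on UNIV"
  shows "((\<lambda>t. f (x + t *\<^sub>R axis i 1)) has_real_derivative
          partial_deriv i f (x + t *\<^sub>R axis i 1)) (at t)"
  using has_derivative_along_axis[OF has_derivative_gradient, of f x t i] assms
  by (simp add: differentiable_on_def gradient_def inner_axis)

lemma C_k_SucD: "C_k (Suc k) f \<Longrightarrow> C_k k f"
  by (induction k arbitrary: f) (auto simp: differentiable_imp_continuous_on)

lemma smooth_imp_C_k: "smooth f \<Longrightarrow> C_k k f"
  by (simp add: smooth_def)

lemma smooth_partial_deriv: "smooth f \<Longrightarrow> smooth (partial_deriv i f)"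
  unfolding smooth_def using C_k.simps(2) by blast

lemma smooth_differentiable: "smooth f \<Longrightarrow> f differentiable (at x)"
  using smooth_imp_C_k[of f "Suc 0"] by (auto simp: differentiable_on_def)

lemma C_k_const: "C_k k (\<lambda>x. c)"
proof (induction k arbitrary: c)
  case (Suc k)
  have "partial_deriv i (\<lambda>x. c) = (\<lambda>x. 0)" for i :: 'a
    by (auto simp: fun_eq_iff partial_deriv_def intro!: DERIV_imp_deriv)
  then show ?case using Suc by simp
qed simp

lemma C_k_add:
  assumes "C_k k f" "C_k k g" shows "C_k k (\<lambda>x. f x + g x)"
  using assms
proof (induction k arbitrary: f g)
  case (Suc k)
  have d: "f differentiable (at x)" "g differentiable (at x)" for x
    using Suc.prems by (auto simp: differentiable_on_def)
  have "partial_deriv i (\<lambda>x. f x + g x) = (\<lambda>x. partial_deriv i f x + partial_deriv i g x)" for i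
    by (rule ext, subst partial_deriv_eq,
        rule has_derivative_add[OF has_derivative_gradient[OF d(1)] has_derivative_gradient[OF d(2)]])
      (simp add: gradient_def inner_axis)
  then show ?case using Suc by simp
qed (simp add: continuous_on_add)

lemma C_k_mult:
  assumes "C_k k f" "C_k k g" shows "C_k k (\<lambda>x. f x * g x)"
  using assms
proof (induction k arbitrary: f g)
  case (Suc k)
  have d: "f differentiable (at x)" "g differentiable (at x)" for x
    using Suc.prems by (auto simp: differentiable_on_def)
  have "partial_deriv i (\<lambda>x. f x * g x)
      = (\<lambda>x. f x * partial_deriv i g x + partial_deriv i f x * g x)" for i
    by (rule ext, subst partial_deriv_eq,
        rule has_derivative_mult[OF has_derivative_gradient[OF d(1)] has_derivative_gradient[OF d(2)]])
      (simp add: gradient_def inner_axis)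
  then show ?case using Suc C_k_SucD[OF Suc.prems(1)] C_k_SucD[OF Suc.prems(2)]
    by (simp add: C_k_add)
qed (simp add: continuous_on_mult)

lemma C_k_powr:
  assumes "C_k k f" "\<And>x. f x > 0" shows "C_k k (\<lambda>x. f x powr a)"
  using assms
proof (induction k arbitrary: a)
  case 0
  then show ?case by (auto intro!: continuous_on_powr simp: less_imp_neq[symmetric])
next
  case (Suc k)
  have d: "f differentiable (at x)" for x
    using Suc.prems by (auto simp: differentiable_on_def)
  have energy_density: "((\<lambda>x. f x powr a) has_derivative
      (\<lambda>h. a * f x powr (a - 1) * (gradient f x \<bullet> h))) (at x)" for x
    using Suc.prems(2)[of x]
    by (auto intro!: derivative_eq_intros has_derivative_gradient[OF d] simp: powr_diff)
  have "partial_deriv i (\<lambda>x. f x powr a)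
      = (\<lambda>x. a * f x powr (a - 1) * partial_deriv i f x)" for i
    by (rule ext, subst partial_deriv_eq, rule energy_density) (simp add: gradient_def inner_axis)
  moreover have "(\<lambda>x. f x powr a) differentiable_on UNIV"
    using energy_density by (auto simp: differentiable_on_def differentiable_def)
  ultimately show ?case using Suc C_k_SucD[OF Suc.prems(1)]
    by (simp add: C_k_mult C_k_const)
qed

lemma C_k_sum:
  assumes "\<And>i. i \<in> A \<Longrightarrow> C_k k (f i)"
  shows "C_k k (\<lambda>x. \<Sum>i\<in>A. f i x)"
  using assms by (induction A rule: infinite_finite_induct) (auto simp: C_k_const C_k_add)

lemma smooth_const: "smooth (\<lambda>x. c)"
  and smooth_add: "smooth f \<Longrightarrow> smooth g \<Longrightarrow> smooth (\<lambda>x. f x + g x)"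
  and smooth_mult: "smooth f \<Longrightarrow> smooth g \<Longrightarrow> smooth (\<lambda>x. f x * g x)"
  and smooth_powr: "smooth f \<Longrightarrow> (\<And>x. f x > 0) \<Longrightarrow> smooth (\<lambda>x. f x powr a)"
  and smooth_sum: "(\<And>i. i \<in> A \<Longrightarrow> smooth (F i)) \<Longrightarrow> smooth (\<lambda>x. \<Sum>i\<in>A. F i x)"
  by (simp_all add: smooth_def C_k_const C_k_add C_k_mult C_k_powr C_k_sum)

lemma smooth_diff: "smooth f \<Longrightarrow> smooth g \<Longrightarrow> smooth (\<lambda>x. f x - g x)"
  using smooth_add[of f "\<lambda>x. - 1 * g x"] smooth_mult[OF smooth_const] by fastforce

lemma smooth_component: "smooth (\<lambda>x. x $ i)"
proof -
  have energy_density: "((\<lambda>x. x $ i) has_derivative (\<lambda>h. h $ i)) (at x)" for x :: "real ^ 'a"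
    by (rule bounded_linear_imp_has_derivative[OF bounded_linear_vec_nth])
  have "partial_deriv j (\<lambda>x. x $ i) = (\<lambda>x. axis j 1 $ i)" for j
    by (rule ext) (rule partial_deriv_eq[OF energy_density])
  then have "C_k (Suc k) (\<lambda>x. x $ i)" for k
    using energy_density by (auto simp: C_k_const differentiable_on_def differentiable_def)
  then show ?thesis unfolding smooth_def using C_k_SucD by blast
qed

lemma C_1_compose:
  assumes "smooth f" and "\<And>s. (w has_real_derivative w' s) (at s)" and "continuous_on UNIV w'"
  shows "C_k (Suc 0) (\<lambda>x. w (f x))"
proof -
  have energy_density: "((\<lambda>x. w (f x)) has_derivative (\<lambda>h. w' (f x) * (gradient f x \<bullet> h))) (at x)" for x
    using has_derivative_gradient[OF smooth_differentiable[OF assms(1)]]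
    by (auto intro!: derivative_eq_intros has_derivative_compose[OF _ assms(2)[unfolded has_field_derivative_def]])
  have "partial_deriv i (\<lambda>x. w (f x)) = (\<lambda>x. w' (f x) * partial_deriv i f x)" for i
    by (rule ext, subst partial_deriv_eq, rule energy_density) (simp add: gradient_def inner_axis)
  moreover have "continuous_on UNIV f" "continuous_on UNIV (partial_deriv i f)" for i
    using smooth_imp_C_k[OF assms(1), of 0] smooth_imp_C_k[OF smooth_partial_deriv[OF assms(1)], of 0]
    by auto
  ultimately show ?thesis using energy_density assms(3)
    by (auto simp: differentiable_on_def differentiable_def
        intro!: continuous_on_mult continuous_on_compose2[OF assms(3)])
qed

text \<open>The second difference is symmetric in \<open>i\<close> and \<open>j\<close>, while the mean value theorem, applied first
  along \<open>i\<close> and then along \<open>j\<close>, evaluates it by one of the two mixed derivatives. Exchanging the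
  roles of \<open>i\<close> and \<open>j\<close> therefore compares the two.\<close>

lemma second_difference_mean_value:
  fixes f :: "real ^ 'n::finite \<Rightarrow> real"
  assumes f: "f differentiable_on UNIV" and g: "partial_deriv i f differentiable_on UNIV"
    and t: "t > 0"
  shows "\<exists>a b. 0 < a \<and> a < t \<and> 0 < b \<and> b < t \<and>
     f (x + t *\<^sub>R axis i 1 + t *\<^sub>R axis j 1) - f (x + t *\<^sub>R axis i 1) - f (x + t *\<^sub>R axis j 1) + f x
     = t\<^sup>2 * partial_deriv j (partial_deriv i f) (x + a *\<^sub>R axis i 1 + b *\<^sub>R axis j 1)"
proof -
  let ?e = "axis i 1 :: real ^ 'n" and ?e' = "axis j 1 :: real ^ 'n"
  let ?g = "\<lambda>s. f ((x + t *\<^sub>R ?e') + s *\<^sub>R ?e) - f (x + s *\<^sub>R ?e)"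
  have "\<exists>a. 0 < a \<and> a < t \<and> ?g t - ?g 0 = (t - 0) *
      (partial_deriv i f ((x + t *\<^sub>R ?e') + a *\<^sub>R ?e) - partial_deriv i f (x + a *\<^sub>R ?e))"
    by (rule MVT2[OF t]) (auto intro!: DERIV_diff partial_deriv_along_axis[OF f])
  then obtain a where a: "0 < a" "a < t" and 1: "?g t - ?g 0 = t *
      (partial_deriv i f ((x + t *\<^sub>R ?e') + a *\<^sub>R ?e) - partial_deriv i f (x + a *\<^sub>R ?e))"
    by auto
  let ?h = "\<lambda>s. partial_deriv i f ((x + a *\<^sub>R ?e) + s *\<^sub>R ?e')"
  have "\<exists>b. 0 < b \<and> b < t \<and> ?h t - ?h 0 = (t - 0) *
      partial_deriv j (partial_deriv i f) ((x + a *\<^sub>R ?e) + b *\<^sub>R ?e')"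
    by (rule MVT2[OF t]) (rule partial_deriv_along_axis[OF g])
  then obtain b where b: "0 < b" "b < t" and 2: "?h t - ?h 0 = t *
      partial_deriv j (partial_deriv i f) ((x + a *\<^sub>R ?e) + b *\<^sub>R ?e')"
    by auto
  show ?thesis using a b 1 2
    by (intro exI[of _ a] exI[of _ b]) (simp add: power2_eq_square add_ac)
qed

lemma partial_deriv_commute:
  assumes f: "C_k 2 f"
  shows "partial_deriv i (partial_deriv j f) x = partial_deriv j (partial_deriv i f) x"
proof -
  let ?e = "axis i 1 :: real ^ 'a" and ?e' = "axis j 1 :: real ^ 'a"
  define t where "t m = 1 / real (Suc m)" for m
  have t: "t m > 0" for m by (simp add: t_def)
  have t0: "t \<longlonglongrightarrow> 0" unfolding t_def by (rule LIMSEQ_Suc[OF lim_1_over_n])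
  have d: "f differentiable_on UNIV" "partial_deriv k f differentiable_on UNIV"
    "continuous_on UNIV (partial_deriv l (partial_deriv k f))" for k l
    using f by (auto simp: numeral_2_eq_2)
  define Q where "Q m = (f (x + t m *\<^sub>R ?e + t m *\<^sub>R ?e') - f (x + t m *\<^sub>R ?e)
      - f (x + t m *\<^sub>R ?e') + f x) / (t m)\<^sup>2" for m
  have lim: "Q \<longlonglongrightarrow> partial_deriv l (partial_deriv k f) x"
    if kl: "k = i \<and> l = j \<or> k = j \<and> l = i" for k l
  proof -
    let ?k = "axis k 1 :: real ^ 'a" and ?l = "axis l 1 :: real ^ 'a"
    have "\<exists>a b. 0 < a \<and> a < t m \<and> 0 < b \<and> b < t m \<and>
       Q m = partial_deriv l (partial_deriv k f) (x + a *\<^sub>R ?k + b *\<^sub>R ?l)" for m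
    proof -
      obtain a b where ab: "0 < a" "a < t m" "0 < b" "b < t m" and
        "f (x + t m *\<^sub>R ?k + t m *\<^sub>R ?l) - f (x + t m *\<^sub>R ?k) - f (x + t m *\<^sub>R ?l) + f x
         = (t m)\<^sup>2 * partial_deriv l (partial_deriv k f) (x + a *\<^sub>R ?k + b *\<^sub>R ?l)"
        using second_difference_mean_value[OF d(1) d(2) t] by blast
      then have "Q m = partial_deriv l (partial_deriv k f) (x + a *\<^sub>R ?k + b *\<^sub>R ?l)"
        using kl t[of m] by (auto simp: Q_def field_simps add_ac)
      then show ?thesis using ab by blast
    qed
    then obtain a b where ab: "\<And>m. 0 < a m" "\<And>m. a m < t m" "\<And>m. 0 < b m" "\<And>m. b m < t m"
      and Q: "\<And>m. Q m = partial_deriv l (partial_deriv k f) (x + a m *\<^sub>R ?k + b m *\<^sub>R ?l)"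
      by metis
    have "a \<longlonglongrightarrow> 0" "b \<longlonglongrightarrow> 0"
      using ab by (auto intro!: tendsto_sandwich[OF _ _ tendsto_const t0] always_eventually less_imp_le)
    then have "(\<lambda>m. x + a m *\<^sub>R ?k + b m *\<^sub>R ?l) \<longlonglongrightarrow> x + 0 *\<^sub>R ?k + 0 *\<^sub>R ?l"
      by (intro tendsto_intros)
    then have "(\<lambda>m. partial_deriv l (partial_deriv k f) (x + a m *\<^sub>R ?k + b m *\<^sub>R ?l))
        \<longlonglongrightarrow> partial_deriv l (partial_deriv k f) x"
      by (intro continuous_on_tendsto_compose[OF d(3)]) auto
    then show ?thesis by (simp add: Q[abs_def])
  qed
  show ?thesis using LIMSEQ_unique[OF lim lim] by blast
qed

section \<open>The divergence theorem for compactly supported fields\<close>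

lemma integrable_compact_support:
  fixes g :: "real ^ 'n::finite \<Rightarrow> real"
  assumes "continuous_on UNIV g" "compact K" "\<And>x. x \<notin> K \<Longrightarrow> g x = 0"
  shows "integrable lborel g"
proof -
  have "(\<lambda>x. indicator K x *\<^sub>R g x) = g"
    using assms(3) by (auto simp: fun_eq_iff indicator_def)
  then show ?thesis
    using borel_integrable_compact[OF assms(2) continuous_on_subset[OF assms(1)]] by simp
qed

text \<open>Lebesgue measure is translation invariant, so every difference quotient of \<open>F\<close> has integral zero.
  The quotients converge to the partial derivative, and are dominated because the derivative is
  bounded and the supports stay in one ball.\<close>

lemma integral_partial_deriv_eq_0:
  fixes F :: "real ^ 'n::finite \<Rightarrow> real"
  assumes C1: "C_k (Suc 0) F" and K: "compact K" and F0: "\<And>x. x \<notin> K \<Longrightarrow> F x = 0"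
  shows "integrable lborel (partial_deriv i F)" and "(LINT x|lborel. partial_deriv i F x) = 0"
proof -
  let ?e = "axis i 1 :: real ^ 'n" and ?G = "partial_deriv i F"
  have dF: "F differentiable_on UNIV" and cG: "continuous_on UNIV ?G"
    using C1 by auto
  have cF: "continuous_on UNIV F" using dF by (rule differentiable_imp_continuous_on)
  have G0: "?G x = 0" if "x \<notin> K" for x
  proof -
    have "open (- K)" using K by (simp add: compact_imp_closed open_Compl)
    then have "(F has_derivative (\<lambda>h. 0)) (at x)"
      using that F0 by (intro has_derivative_transform_within_open[OF has_derivative_const[of 0]]) auto
    then show ?thesis by (rule partial_deriv_eq)
  qed
  show int: "integrable lborel ?G" by (rule integrable_compact_support[OF cG K G0])
  obtain R where R: "K \<subseteq> cball 0 R" "R > 0"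
    using bounded_subset_ballD[OF compact_imp_bounded[OF K], of 0] ball_subset_cball by blast
  have "bounded (?G ` K)"
    by (intro compact_imp_bounded compact_continuous_image continuous_on_subset[OF cG] K) auto
  then obtain B where B: "B > 0" "\<forall>y\<in>?G ` K. norm y \<le> B" by (auto simp: bounded_pos)
  have GB: "\<bar>?G x\<bar> \<le> B" for x
    using B G0[of x] by (cases "x \<in> K") auto
  define t where "t m = 1 / real (Suc m)" for m
  have t: "t m > 0" "t m \<le> 1" for m by (simp_all add: t_def)
  have t0: "t \<longlonglongrightarrow> 0" unfolding t_def by (rule LIMSEQ_Suc[OF lim_1_over_n])
  define g where "g m x = (F (x + t m *\<^sub>R ?e) - F x) / t m" for m x
  have lim: "(\<lambda>m. g m x) \<longlonglongrightarrow> ?G x" for x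
  proof -
    have "((\<lambda>h. (F (x + h *\<^sub>R ?e) - F x) / h) \<longlongrightarrow> ?G x) (at 0)"
      using partial_deriv_along_axis[OF dF, of x i 0] by (simp add: DERIV_def)
    moreover have "filterlim t (at 0) sequentially"
      using t t0 by (auto simp: filterlim_at intro!: always_eventually dest: less_imp_neq)
        (metis less_numeral_extra(3))
    ultimately show ?thesis unfolding g_def by (rule filterlim_compose)
  qed
  have bound: "norm (g m x) \<le> indicator (cball 0 (R + 1)) x *\<^sub>R B" for m x
  proof (cases "x \<in> cball 0 (R + 1)")
    case True
    have "\<exists>z. 0 < z \<and> z < t m \<and> F (x + t m *\<^sub>R ?e) - F (x + 0 *\<^sub>R ?e)
        = (t m - 0) * ?G (x + z *\<^sub>R ?e)"
      by (rule MVT2[OF t(1)]) (rule partial_deriv_along_axis[OF dF])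
    then obtain z where "F (x + t m *\<^sub>R ?e) - F x = t m * ?G (x + z *\<^sub>R ?e)" by auto
    then have "g m x = ?G (x + z *\<^sub>R ?e)" using t[of m] by (simp add: g_def)
    then show ?thesis using GB True by simp
  next
    case False
    have "norm x \<le> norm (x + t m *\<^sub>R ?e) + norm (t m *\<^sub>R ?e)"
      using norm_triangle_ineq4[of "x + t m *\<^sub>R ?e" "t m *\<^sub>R ?e"] by simp
    then have "norm x \<le> norm (x + t m *\<^sub>R ?e) + 1" using t[of m] by simp
    then have "x + t m *\<^sub>R ?e \<notin> K" "x \<notin> K" using False R by (auto simp: subset_iff)
    then show ?thesis using False F0 by (simp add: g_def)
  qed
  have intF: "integrable lborel F" by (rule integrable_compact_support[OF cF K F0])
  have shift: "integrable lborel (\<lambda>x. F (c + x))" "(LINT x|lborel. F (c + x)) = (LINT x|lborel. F x)" for c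
  proof -
    have m: "F \<in> borel_measurable borel" using cF by (rule borel_measurable_continuous_onI)
    have e: "distr lborel lborel ((+) c) = (lborel :: (real ^ 'n) measure)"
      using lborel_distr_plus[of c] by (metis distr_cong sets_lborel)
    show "integrable lborel (\<lambda>x. F (c + x))"
      using integrable_distr[of "(+) c" lborel lborel F] intF e by simp
    show "(LINT x|lborel. F (c + x)) = (LINT x|lborel. F x)"
      using integral_distr[of "(+) c" lborel lborel F] m e by simp
  qed
  have g_int: "(LINT x|lborel. g m x) = 0" for m
    using intF shift[of "t m *\<^sub>R ?e"] by (simp add: g_def add.commute)
  have "(\<lambda>m. LINT x|lborel. g m x) \<longlonglongrightarrow> (LINT x|lborel. ?G x)"
  proof (rule integral_dominated_convergence)
    show "integrable lborel (\<lambda>x. indicator (cball 0 (R + 1)) x *\<^sub>R B)"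
      by (rule borel_integrable_compact) auto
    show "?G \<in> borel_measurable lborel" using int by simp
    show "g m \<in> borel_measurable lborel" for m
      using intF shift(1)[of "t m *\<^sub>R ?e"] unfolding g_def[abs_def]
      by (intro borel_measurable_divide borel_measurable_diff) (simp_all add: add.commute)
    show "AE x in lborel. norm (g m x) \<le> indicator (cball 0 (R + 1)) x *\<^sub>R B" for m
      by (intro AE_I2 bound)
  qed (simp add: lim)
  then show "(LINT x|lborel. ?G x) = 0" using LIMSEQ_unique by (simp add: g_int LIMSEQ_const_iff)
qed

lemma integral_divergence_eq_0:
  assumes "\<And>i. C_k (Suc 0) (\<lambda>x. X x $ i)" and "compact K" and "\<And>x. x \<notin> K \<Longrightarrow> X x = 0"
  shows "integrable lborel (divergence X)" and "(LINT x|lborel. divergence X x) = 0"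
  using integral_partial_deriv_eq_0[OF assms(1,2)] assms(3)
  by (auto simp: divergence_def[abs_def])

lemma divergence_scaleR:
  assumes f: "(f has_derivative f') (at x)" and X: "\<And>i. (\<lambda>y. X y $ i) differentiable (at x)"
  shows "divergence (\<lambda>y. f y *\<^sub>R X y) x = f' (X x) + f x * divergence X x"
proof -
  have "partial_deriv i (\<lambda>y. (f y *\<^sub>R X y) $ i) x
      = f x * partial_deriv i (\<lambda>y. X y $ i) x + f' (axis i 1) * X x $ i" for i
    using partial_deriv_eq[OF has_derivative_mult[OF f has_derivative_gradient[OF X]], of i i]
    by (simp add: gradient_def inner_axis)
  moreover have "f' (X x) = (\<Sum>i\<in>UNIV. f' (axis i 1) * X x $ i)"
  proof -
    have "f' = (\<lambda>h. gradient f x \<bullet> h)"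
      using has_derivative_unique[OF f has_derivative_gradient] f by (auto simp: differentiable_def)
    then show ?thesis by (simp add: inner_axis) (simp add: inner_vec_def)
  qed
  ultimately show ?thesis
    by (simp add: divergence_def sum.distrib sum_distrib_left)
qed

lemma divergence_diff:
  assumes "\<And>i. (\<lambda>y. X y $ i) differentiable (at x)" "\<And>i. (\<lambda>y. Y y $ i) differentiable (at x)"
  shows "divergence (\<lambda>y. X y - Y y) x = divergence X x - divergence Y x"
proof -
  have "partial_deriv i (\<lambda>y. (X y - Y y) $ i) x
      = partial_deriv i (\<lambda>y. X y $ i) x - partial_deriv i (\<lambda>y. Y y $ i) x" for i
    using partial_deriv_eq[OF has_derivative_diff[OF has_derivative_gradient[OF assms(1)]
          has_derivative_gradient[OF assms(2)]], of i i]
    by (simp add: gradient_def inner_axis)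
  then show ?thesis by (simp add: divergence_def sum_subtractf)
qed

lemma divergence_const: "divergence (\<lambda>y. c) x = 0"
  by (simp add: divergence_def partial_deriv_eq[OF has_derivative_const])

lemma divergence_ident: "divergence (\<lambda>y :: real ^ 'n::finite. y) x = real CARD('n)"
proof -
  have "((\<lambda>y. y $ i) has_derivative (\<lambda>h. h $ i)) (at x)" for i
    by (rule bounded_linear_imp_has_derivative[OF bounded_linear_vec_nth])
  from partial_deriv_eq[OF this] show ?thesis by (simp add: divergence_def)
qed

lemma nonneg_integral_le_0_imp_eq_0:
  fixes g :: "real ^ 'n::finite \<Rightarrow> real"
  assumes "continuous_on UNIV g" "\<And>x. g x \<ge> 0" "integrable lborel g" "(LINT x|lborel. g x) \<le> 0"
  shows "g x = 0"
proof -
  have "(LINT x|lborel. g x) = 0" using assms(2,4) by (simp add: order_antisym)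
  then have "AE x in lborel. g x = 0"
    using integral_nonneg_eq_0_iff_AE[OF assms(3)] assms(2) by auto
  then have "AE x in lebesgue. x \<in> UNIV \<longrightarrow> x \<in> {x. g x = 0}"
    by (auto intro: AE_completion)
  moreover have "closed {x. g x = 0}"
    using continuous_closed_preimage_constant[OF assms(1) closed_UNIV, of 0] by simp
  ultimately show ?thesis using mem_closed_if_AE_lebesgue_open[of UNIV "{x. g x = 0}" x] by auto
qed

section \<open>A decreasing cutoff\<close>

text \<open>The square makes the cutoff continuously differentiable, and it is also what Young's inequality
  absorbs in the energy estimate: the derivative is a multiple of the square root of the cutoff.\<close>

definition cutoff where "cutoff S s = (max 0 (1 - s / S))\<^sup>2" for S s :: real

lemma pos_part_sq_has_derivative:
  "((\<lambda>t::real. (max 0 t)\<^sup>2) has_real_derivative 2 * max 0 t) (at t)"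
proof -
  consider "t > 0" | "t < 0" | "t = 0" by linarith
  then show ?thesis
  proof cases
    case 1
    have "((\<lambda>t::real. t\<^sup>2) has_real_derivative 2 * max 0 t) (at t)"
      using 1 by (auto intro!: derivative_eq_intros)
    then show ?thesis
      by (rule has_field_derivative_transform_within_open[where S = "{0<..}"]) (use 1 in auto)
  next
    case 2
    have "((\<lambda>t::real. 0) has_real_derivative 2 * max 0 t) (at t)" using 2 by simp
    then show ?thesis
      by (rule has_field_derivative_transform_within_open[where S = "{..<0}"]) (use 2 in auto)
  next
    case 3
    have "((\<lambda>h::real. (max 0 h)\<^sup>2 / h) \<longlongrightarrow> 0) (at 0)"
    proof (rule Lim_null_comparison)
      show "eventually (\<lambda>h::real. norm ((max 0 h)\<^sup>2 / h) \<le> \<bar>h\<bar>) (at 0)"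
        by (intro always_eventually) (auto simp: max_def power2_eq_square)
      show "((\<lambda>h::real. \<bar>h\<bar>) \<longlongrightarrow> 0) (at 0)" by (auto intro!: tendsto_eq_intros)
    qed
    then show ?thesis using 3 by (simp add: DERIV_def)
  qed
qed

lemma cutoff_has_derivative:
  assumes "S > 0"
  shows "(cutoff S has_real_derivative - (2 / S) * max 0 (1 - s / S)) (at s)"
  unfolding cutoff_def[abs_def]
  by (rule DERIV_chain2[OF pos_part_sq_has_derivative, THEN DERIV_cong])
    (use assms in \<open>auto intro!: derivative_eq_intros\<close>)

lemma cutoff_exp_has_derivative:
  assumes "S > 0"
  shows "((\<lambda>s. cutoff S s * exp (- s)) has_real_derivative
     - (2 / S * max 0 (1 - s / S) + cutoff S s) * exp (- s)) (at s)"
  by (rule DERIV_mult[OF cutoff_has_derivative[OF assms], THEN DERIV_cong])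
    (auto intro!: derivative_eq_intros simp: algebra_simps)

lemma cutoff_nonneg: "cutoff S s \<ge> 0"
  by (simp add: cutoff_def)

lemma cutoff_le_1: "S > 0 \<Longrightarrow> s \<ge> 0 \<Longrightarrow> cutoff S s \<le> 1"
  by (simp add: cutoff_def power_le_one)

lemma cutoff_eq_0: "S > 0 \<Longrightarrow> s \<ge> S \<Longrightarrow> cutoff S s = 0"
  by (simp add: cutoff_def)

lemma cutoff_pos: "S > 0 \<Longrightarrow> s < S \<Longrightarrow> cutoff S s > 0"
  by (simp add: cutoff_def)

lemma quarter_le_cutoff: "S > 0 \<Longrightarrow> s \<le> S \<Longrightarrow> 1 / 4 \<le> cutoff (2 * S) s"
  using power_mono[of "1 / 2" "max 0 (1 - s / (2 * S))" 2]
  by (simp add: cutoff_def power_divide max_def field_simps)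

lemma cutoff_mono: "0 < S \<Longrightarrow> S \<le> S' \<Longrightarrow> 0 \<le> s \<Longrightarrow> cutoff S s \<le> cutoff S' s"
  unfolding cutoff_def
  by (intro power_mono max.mono diff_mono divide_left_mono) auto

lemma continuous_on_cutoff: "continuous_on A g \<Longrightarrow> continuous_on A (\<lambda>x. cutoff S (g x))"
  unfolding cutoff_def by (cases "S = 0") (auto intro!: continuous_intros)

section \<open>The geometry of a graphical self-shrinker\<close>

locale self_shrinker_graph =
  fixes u :: "real ^ 'n::finite \<Rightarrow> real"
  assumes smooth_u: "smooth u"
    and equation: "\<And>x. divergence (\<lambda>y. (1 / sqrt (1 + (norm (gradient u y))\<^sup>2)) *\<^sub>R gradient u y) x
           = ((\<Sum>i\<in>UNIV. x $ i * partial_deriv i u x) - u x)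
               / (2 * sqrt (1 + (norm (gradient u x))\<^sup>2))"
begin

abbreviation p where "p \<equiv> gradient u"

text \<open>\<open>W\<close> is the area element, \<open>N\<close> is minus the horizontal part of the upward unit normal,
  \<open>exp (-f)\<close> is the Gaussian weight, \<open>Df\<close> is the gradient of \<open>f\<close>, and \<open>H\<close> is the mean curvature prescribed by
  the equation. \<open>Q\<close> is the inverse of the induced metric, divided by \<open>W\<close>; its matrix is also the
  derivative of the map \<open>p \<mapsto> p / sqrt (1 + |p|\<^sup>2)\<close>, which is why it governs the linearised equation.\<close>

definition W where "W x = sqrt (1 + p x \<bullet> p x)"
definition N where "N x = (1 / W x) *\<^sub>R p x"
definition f where "f x = (x \<bullet> x + (u x)\<^sup>2) / 4"
definition Df where "Df x = (1 / 2) *\<^sub>R (x + u x *\<^sub>R p x)"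
definition H where "H x = (x \<bullet> p x - u x) / (2 * W x)"
definition Hess where "Hess x h = (\<chi> i. gradient (partial_deriv i u) x \<bullet> h)"
definition Q where "Q x a b = (a \<bullet> b - (N x \<bullet> a) * (N x \<bullet> b)) / W x"

lemma W_pos: "W x > 0" and W_sq: "(W x)\<^sup>2 = 1 + p x \<bullet> p x"
proof -
  show "(W x)\<^sup>2 = 1 + p x \<bullet> p x" by (simp add: W_def add_nonneg_nonneg)
  show "W x > 0" by (simp add: W_def add_pos_nonneg)
qed

lemma p_eq: "p x = W x *\<^sub>R N x"
  using W_pos[of x] by (simp add: N_def)

lemma N_inner_N: "N x \<bullet> N x = 1 - 1 / (W x)\<^sup>2"
proof -
  have "N x \<bullet> N x = (p x \<bullet> p x) / (W x)\<^sup>2" by (simp add: N_def power2_eq_square)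
  also have "\<dots> = ((W x)\<^sup>2 - 1) / (W x)\<^sup>2" by (simp add: W_sq)
  finally show ?thesis using W_pos[of x] by (simp add: diff_divide_distrib)
qed

lemma position_inner_gradient: "x \<bullet> p x = 2 * H x * W x + u x"
proof -
  have "2 * H x * W x = x \<bullet> p x - u x" using W_pos[of x] by (simp add: H_def)
  then show ?thesis by simp
qed

lemma divergence_N: "divergence N x = H x"
proof -
  have "N = (\<lambda>y. (1 / sqrt (1 + (norm (p y))\<^sup>2)) *\<^sub>R p y)"
    by (simp add: fun_eq_iff N_def W_def power2_norm_eq_inner)
  then show ?thesis
    using equation[of x] by (simp add: H_def W_def power2_norm_eq_inner inner_vec_def gradient_def)
qed

lemma smooth_p: "smooth (\<lambda>x. p x $ i)"
  using smooth_partial_deriv[OF smooth_u] by (simp add: gradient_def)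

lemma smooth_W_powr: "smooth (\<lambda>x. W x powr a)"
proof -
  have "smooth (\<lambda>x. (1 + (\<Sum>i\<in>UNIV. p x $ i * p x $ i)) powr (a / 2))"
    by (intro smooth_powr smooth_add smooth_const smooth_sum smooth_mult smooth_p)
      (simp add: add_pos_nonneg sum_nonneg)
  also have "(\<lambda>x. (1 + (\<Sum>i\<in>UNIV. p x $ i * p x $ i)) powr (a / 2)) = (\<lambda>x. W x powr a)"
  proof
    fix x
    have "W x powr a = ((W x)\<^sup>2) powr (a / 2)"
      using W_pos[of x] by (simp add: powr_powr flip: powr_numeral)
    then show "(1 + (\<Sum>i\<in>UNIV. p x $ i * p x $ i)) powr (a / 2) = W x powr a"
      by (simp add: W_sq inner_vec_def)
  qed
  finally show ?thesis .
qed

lemma smooth_W: "smooth W"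
  using smooth_W_powr[of 1] W_pos by (simp add: less_imp_le)

lemma smooth_N: "smooth (\<lambda>x. N x $ i)"
proof -
  have "(\<lambda>x. N x $ i) = (\<lambda>x. W x powr - 1 * p x $ i)"
    using W_pos by (simp add: fun_eq_iff N_def powr_minus divide_inverse less_imp_le)
  then show ?thesis by (simp only:) (intro smooth_mult smooth_W_powr smooth_p)
qed

lemma smooth_f: "smooth f"
proof -
  have "f = (\<lambda>x. 1 / 4 * ((\<Sum>i\<in>UNIV. x $ i * x $ i) + u x * u x))"
    by (simp add: fun_eq_iff f_def inner_vec_def power2_eq_square)
  then show ?thesis
    by (simp only:) (intro smooth_mult smooth_const smooth_add smooth_sum smooth_component smooth_u)
qed

lemma smooth_legendre: "smooth (\<lambda>x. x \<bullet> p x - u x)"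
  unfolding inner_vec_def inner_real_def
  by (intro smooth_diff smooth_sum smooth_mult smooth_component smooth_p smooth_u)

lemma has_derivative_u: "(u has_derivative (\<lambda>h. p x \<bullet> h)) (at x)"
  by (rule has_derivative_gradient[OF smooth_differentiable[OF smooth_u]])

lemma has_derivative_p: "(p has_derivative Hess x) (at x)"
  using has_derivative_gradient[OF smooth_differentiable[OF smooth_partial_deriv[OF smooth_u]]]
  by (subst has_derivative_componentwise_within)
    (auto simp: Basis_vec_def inner_axis Hess_def gradient_def)

lemma Hess_axis: "Hess x (axis k 1) = gradient (partial_deriv k u) x"
  using partial_deriv_commute[OF smooth_imp_C_k[OF smooth_u]]
  by (simp add: vec_eq_iff Hess_def inner_axis gradient_def)

lemma Hess_symmetric: "a \<bullet> Hess x b = b \<bullet> Hess x a"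
proof -
  have "a \<bullet> Hess x b = (\<Sum>i\<in>UNIV. \<Sum>j\<in>UNIV. a $ i * (partial_deriv j (partial_deriv i u) x * b $ j))"
    for a b by (simp add: inner_vec_def Hess_def gradient_def sum_distrib_left)
  then show ?thesis
    by (simp, subst sum.swap)
      (simp add: partial_deriv_commute[OF smooth_imp_C_k[OF smooth_u]] mult_ac)
qed

lemma has_derivative_W: "(W has_derivative (\<lambda>h. N x \<bullet> Hess x h)) (at x)"
proof -
  have "1 + p x \<bullet> p x > 0" by (simp add: add_pos_nonneg)
  then show ?thesis unfolding W_def[abs_def]
    by (auto intro!: derivative_eq_intros has_derivative_p
        simp: fun_eq_iff N_def W_def inner_commute field_simps)
qed

lemma has_derivative_f: "(f has_derivative (\<lambda>h. Df x \<bullet> h)) (at x)"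
  unfolding f_def[abs_def]
  by (auto intro!: derivative_eq_intros has_derivative_u
      simp: fun_eq_iff Df_def inner_commute inner_add_right field_simps)

text \<open>The terms in the undifferentiated gradient cancel; this is why the linearised equation has no
  term of order zero.\<close>

lemma has_derivative_legendre:
  "((\<lambda>y. y \<bullet> p y - u y) has_derivative (\<lambda>h. x \<bullet> Hess x h)) (at x)"
  by (auto intro!: derivative_eq_intros has_derivative_u has_derivative_p simp: fun_eq_iff inner_commute)

lemma has_derivative_H:
  "(H has_derivative (\<lambda>h. (x - (2 * H x) *\<^sub>R N x) \<bullet> Hess x h / (2 * W x))) (at x)"
proof -
  have "(H has_derivative (\<lambda>h. ((x \<bullet> Hess x h) * (2 * W x)
      - (x \<bullet> p x - u x) * (2 * (N x \<bullet> Hess x h))) / ((2 * W x) * (2 * W x)))) (at x)"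
    unfolding H_def[abs_def] using W_pos[of x]
    by (intro has_derivative_divide' has_derivative_legendre has_derivative_mult_right
        has_derivative_W) simp
  then show ?thesis
    by (rule has_derivative_eq_rhs)
      (use W_pos[of x] in \<open>simp add: fun_eq_iff inner_diff_left position_inner_gradient field_simps\<close>)
qed

text \<open>\<open>N\<close> has length less than one, by an amount that \<open>N_inner_N\<close> makes explicit; so Cauchy-Schwarz
  gives ellipticity.\<close>

lemma Q_self_nonneg: "Q x a a \<ge> 0"
  and norm_sq_le_Q: "a \<bullet> a \<le> (W x) ^ 3 * Q x a a"
proof -
  have "(N x \<bullet> a)\<^sup>2 \<le> (N x \<bullet> N x) * (a \<bullet> a)" by (rule Cauchy_Schwarz_ineq)
  then have *: "(a \<bullet> a) / (W x)\<^sup>2 \<le> a \<bullet> a - (N x \<bullet> a)\<^sup>2"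
    by (simp add: N_inner_N algebra_simps)
  have "a \<bullet> a = (W x)\<^sup>2 * ((a \<bullet> a) / (W x)\<^sup>2)" using W_pos[of x] by simp
  also have "\<dots> \<le> (W x)\<^sup>2 * (a \<bullet> a - (N x \<bullet> a)\<^sup>2)" using * by (intro mult_left_mono) auto
  also have "\<dots> = (W x) ^ 3 * Q x a a"
    using W_pos[of x] by (simp add: Q_def power2_eq_square power3_eq_cube)
  finally show **: "a \<bullet> a \<le> (W x) ^ 3 * Q x a a" .
  have "0 \<le> (W x) ^ 3 * Q x a a" using inner_ge_zero[of a] ** by linarith
  then show "Q x a a \<ge> 0" using W_pos[of x] by (simp add: zero_le_mult_iff)
qed

text \<open>\<open>2 H\<close> is, up to sign, the normal component of the position vector \<open>(x, u x)\<close>, and \<open>4 f\<close> is the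
  squared length of that vector.\<close>

lemma H_sq_le_f: "(H x)\<^sup>2 \<le> f x"
proof -
  have "(x \<bullet> p x - u x)\<^sup>2 = ((x, u x) \<bullet> (p x, - 1 :: real))\<^sup>2" by simp
  also have "\<dots> \<le> ((x, u x) \<bullet> (x, u x)) * ((p x, - 1 :: real) \<bullet> (p x, - 1))" by (rule Cauchy_Schwarz_ineq)
  also have "\<dots> = 4 * f x * (W x)\<^sup>2" by (simp add: f_def W_sq) (simp add: power2_eq_square algebra_simps)
  finally show ?thesis using W_pos[of x] by (simp add: H_def power_divide field_simps)
qed

lemma position_inner_N: "x \<bullet> N x = 2 * H x + u x / W x"
  using position_inner_gradient[of x] W_pos[of x] by (simp add: N_def field_simps)

lemma gradient_inner_N: "p x \<bullet> N x = W x - 1 / W x"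
  using W_pos[of x] by (simp add: p_eq N_inner_N field_simps power2_eq_square)

text \<open>Both sides are \<open>W\<close> times the matrix of \<open>Q\<close> applied to \<open>Df\<close>. The common value reappears in the
  position field and in the derivative of \<open>H\<close>, which is what turns both into equations with weight
  \<open>exp (-f)\<close>.\<close>

lemma Df_reduced: "Df x - (N x \<bullet> Df x) *\<^sub>R N x = (1 / 2) *\<^sub>R (x - (2 * H x) *\<^sub>R N x)"
proof -
  have "N x \<bullet> Df x = H x + u x * W x / 2"
    by (simp add: Df_def inner_add_right inner_commute[of "N x"] position_inner_N gradient_inner_N
        algebra_simps add_divide_distrib)
  then show ?thesis
    by (simp add: Df_def p_eq[of x] algebra_simps)
qed

lemma Df_inner_reduced: "Df x \<bullet> (x - (2 * H x) *\<^sub>R N x) = 2 * (f x - (H x)\<^sup>2)"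
  using W_pos[of x]
  by (simp add: Df_def f_def inner_diff_right inner_add_left inner_commute[of "p x" x]
      position_inner_gradient position_inner_N gradient_inner_N)
    (simp add: field_simps power2_eq_square)

lemma Q_altdef: "Q x a b = a \<bullet> (b - (N x \<bullet> b) *\<^sub>R N x) / W x"
  by (simp add: Q_def inner_diff_right inner_commute mult.commute)

lemma Q_Df_Df: "Q x (Df x) (Df x) = (f x - (H x)\<^sup>2) / W x"
  unfolding Q_altdef Df_reduced inner_scaleR_right Df_inner_reduced
  by (simp add: diff_divide_distrib)

text \<open>This is \<open>W\<close> times the horizontal part of the component of \<open>(x, u x)\<close> tangential to the graph. The
  form chosen avoids \<open>H\<close>, whose derivative would bring in more terms.\<close>

definition position_field where "position_field x = W x *\<^sub>R x - (x \<bullet> p x - u x) *\<^sub>R N x"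

lemma position_field_eq: "position_field x = W x *\<^sub>R (x - (2 * H x) *\<^sub>R N x)"
  by (simp add: position_field_def position_inner_gradient algebra_simps)

lemma Df_inner_position_field: "Df x \<bullet> position_field x = 2 * W x * (f x - (H x)\<^sup>2)"
  by (simp add: position_field_eq Df_inner_reduced)

text \<open>The second derivatives of \<open>u\<close> cancel: those of \<open>W\<close> contribute \<open>N \<bullet> Hess x\<close> and those of
  \<open>x \<bullet> Du - u\<close> contribute \<open>x \<bullet> Hess N\<close>, which agree by symmetry.\<close>

lemma divergence_position_field: "divergence position_field x = W x * (real CARD('n) - 2 * (H x)\<^sup>2)"
proof -
  have "divergence (\<lambda>y. W y *\<^sub>R y) x = N x \<bullet> Hess x x + W x * real CARD('n)"
    using divergence_scaleR[where X = "\<lambda>y. y", OF has_derivative_W smooth_differentiable[OF smooth_component]]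
    by (simp add: divergence_ident)
  moreover have "divergence (\<lambda>y. (y \<bullet> p y - u y) *\<^sub>R N y) x
      = x \<bullet> Hess x (N x) + (x \<bullet> p x - u x) * H x"
    using smooth_differentiable[OF smooth_N]
    by (simp add: divergence_scaleR[OF has_derivative_legendre] divergence_N)
  moreover have "(\<lambda>y. (W y *\<^sub>R y) $ i) differentiable (at x)"
     "(\<lambda>y. ((y \<bullet> p y - u y) *\<^sub>R N y) $ i) differentiable (at x)" for i
    using smooth_differentiable[OF smooth_mult[OF smooth_W smooth_component]]
      smooth_differentiable[OF smooth_mult[OF smooth_legendre smooth_N]] by simp_all
  ultimately show ?thesis unfolding position_field_def[abs_def]
    by (simp add: divergence_diff Hess_symmetric[of x _ "N x"] position_inner_gradient
        algebra_simps power2_eq_square)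
qed

lemma smooth_position_field: "smooth (\<lambda>x. position_field x $ i)"
  unfolding position_field_def vector_minus_component vector_scaleR_component real_scaleR_def
  by (intro smooth_diff smooth_mult smooth_legendre smooth_W smooth_component smooth_N)

section \<open>The equation satisfied by the first derivatives\<close>

definition v where "v k = partial_deriv k u"
definition Dv where "Dv k = gradient (v k)"
definition dN where "dN k x = (\<chi> i. partial_deriv k (\<lambda>y. N y $ i) x)"

lemma smooth_v: "smooth (v k)"
  by (simp add: v_def smooth_partial_deriv smooth_u)

lemma has_derivative_v: "(v k has_derivative (\<lambda>h. Dv k x \<bullet> h)) (at x)"
  unfolding Dv_def by (rule has_derivative_gradient[OF smooth_differentiable[OF smooth_v]])

lemma Hess_axis_Dv: "Hess x (axis k 1) = Dv k x"
  by (simp add: Hess_axis Dv_def v_def)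

lemma dN_eq: "dN k x = (1 / W x) *\<^sub>R (Dv k x - (N x \<bullet> Dv k x) *\<^sub>R N x)"
proof -
  have "dN k x $ i = ((1 / W x) *\<^sub>R (Dv k x - (N x \<bullet> Dv k x) *\<^sub>R N x)) $ i" for i
  proof -
    have "((\<lambda>y. p y $ i) has_derivative (\<lambda>h. Hess x h $ i)) (at x)"
      by (rule bounded_linear.has_derivative[OF bounded_linear_vec_nth has_derivative_p])
    then have "((\<lambda>y. p y $ i / W y) has_derivative
        (\<lambda>h. (Hess x h $ i * W x - p x $ i * (N x \<bullet> Hess x h)) / (W x * W x))) (at x)"
      using W_pos[of x] by (intro has_derivative_divide' has_derivative_W) auto
    from partial_deriv_eq[OF this, of k] show ?thesis
      using W_pos[of x] by (simp add: dN_def N_def Hess_axis_Dv field_simps)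
  qed
  then show ?thesis by (simp add: vec_eq_iff)
qed

lemma smooth_dN: "smooth (\<lambda>x. dN k x $ i)"
  by (simp add: dN_def smooth_partial_deriv smooth_N)

lemma inner_dN: "a \<bullet> dN k x = Q x a (Dv k x)"
  by (simp add: dN_eq Q_altdef)

lemma Q_commute: "Q x a b = Q x b a"
  by (simp add: Q_def inner_commute mult.commute)

text \<open>The right-hand side is exactly the drift produced by the weight: the identity is the homogeneous
  equation \<open>div (exp (-f) \<partial>\<^sub>k N) = 0\<close> with the factor \<open>exp (-f)\<close> taken out. It is obtained by
  exchanging \<open>\<partial>\<^sub>k\<close> with the divergence and differentiating \<open>div N = H\<close>.\<close>

lemma divergence_dN: "divergence (dN k) x = Df x \<bullet> dN k x"
proof -
  have "divergence (dN k) x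
      = (\<Sum>i\<in>UNIV. partial_deriv k (partial_deriv i (\<lambda>y. N y $ i)) x)"
    by (simp add: divergence_def dN_def partial_deriv_commute[OF smooth_imp_C_k[OF smooth_N]])
  also have "\<dots> = partial_deriv k (\<lambda>y. \<Sum>i\<in>UNIV. partial_deriv i (\<lambda>y. N y $ i) y) x"
  proof -
    have "((\<lambda>y. \<Sum>i\<in>UNIV. partial_deriv i (\<lambda>y. N y $ i) y) has_derivative
       (\<lambda>h. \<Sum>i\<in>UNIV. gradient (partial_deriv i (\<lambda>y. N y $ i)) x \<bullet> h)) (at x)"
      by (intro has_derivative_sum has_derivative_gradient smooth_differentiable
          smooth_partial_deriv smooth_N)
    from partial_deriv_eq[OF this] show ?thesis by (simp add: inner_axis gradient_def)
  qed
  also have "\<dots> = partial_deriv k H x"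
    using divergence_N by (simp add: divergence_def)
  also have "\<dots> = (x - (2 * H x) *\<^sub>R N x) \<bullet> Dv k x / (2 * W x)"
    by (simp add: partial_deriv_eq[OF has_derivative_H] Hess_axis_Dv)
  also have "\<dots> = Q x (Dv k x) (Df x)"
    unfolding Q_altdef Df_reduced by (simp add: inner_commute[of "Dv k x"])
  finally show ?thesis by (simp add: inner_dN Q_commute)
qed

section \<open>Finiteness of the Gaussian area\<close>

lemma f_nonneg: "f x \<ge> 0" and norm_sq_le_f: "(norm x)\<^sup>2 \<le> 4 * f x"
  by (simp_all add: f_def power2_norm_eq_inner)

lemma cutoff_f_compact_support: "x \<notin> cball 0 (2 * sqrt S) \<Longrightarrow> S > 0 \<Longrightarrow> cutoff S (f x) = 0"
proof (rule cutoff_eq_0)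
  assume "x \<notin> cball 0 (2 * sqrt S)" "S > 0"
  then have "(2 * sqrt S)\<^sup>2 \<le> (norm x)\<^sup>2" by (intro power_mono) auto
  moreover have "(2 * sqrt S)\<^sup>2 = 4 * S" using \<open>S > 0\<close> by (simp add: power_mult_distrib)
  ultimately show "S \<le> f x" using norm_sq_le_f[of x] by linarith
qed

lemma continuous_smooth: "smooth g \<Longrightarrow> continuous_on A g"
  using smooth_imp_C_k[of g 0] continuous_on_subset[OF _ subset_UNIV] by simp

lemma continuous_W: "continuous_on A W" and continuous_f: "continuous_on A f"
  by (rule continuous_smooth, rule smooth_W) (rule continuous_smooth, rule smooth_f)

lemma integrable_cutoff:
  assumes "S > 0" "continuous_on UNIV g"
  shows "integrable lborel (\<lambda>x. cutoff S (f x) * g x)"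
  by (rule integrable_compact_support[where K = "cball 0 (2 * sqrt S)"])
    (use assms in \<open>simp_all add: continuous_on_mult continuous_on_cutoff continuous_f
      cutoff_f_compact_support\<close>)

lemma C_1_cutoff_exp:
  assumes "S > 0"
  shows "C_k (Suc 0) (\<lambda>x. cutoff S (f x) * exp (- f x))"
  by (rule C_1_compose[OF smooth_f cutoff_exp_has_derivative[OF assms]])
    (use assms in \<open>auto intro!: continuous_intros continuous_on_cutoff\<close>)

lemma has_derivative_cutoff_exp:
  assumes "S > 0"
  shows "((\<lambda>x. cutoff S (f x) * exp (- f x)) has_derivative
     (\<lambda>h. - (2 / S * max 0 (1 - f x / S) + cutoff S (f x)) * exp (- f x) * (Df x \<bullet> h))) (at x)"
  by (rule has_derivative_compose[OF has_derivative_f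
      cutoff_exp_has_derivative[OF assms, of "f x", unfolded has_field_derivative_def]])

definition weighted_area where "weighted_area S = (LINT x|lborel. cutoff S (f x) * (W x * exp (- f x)))"

lemma integrable_weighted_area: "S > 0 \<Longrightarrow> integrable lborel (\<lambda>x. cutoff S (f x) * (W x * exp (- f x)))"
  by (intro integrable_cutoff continuous_intros continuous_W continuous_f)

text \<open>Test the position field against the cutoff of \<open>f\<close>. The term with the derivative of the cutoff has
  a sign because the cutoff decreases and \<open>Df \<bullet> position_field \<ge> 0\<close>, so the cut-off integral of
  \<open>(n - 2 f) W exp (-f)\<close> is nonnegative. Where \<open>f > n\<close> the factor is below \<open>- n\<close>, and where
  \<open>f \<le> n\<close> the cutoff at \<open>2 n\<close> is at least a quarter; this is where the constant 8 comes from.\<close>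

lemma weighted_area_bound:
  assumes S: "S > 0"
  shows "weighted_area S \<le> 8 * weighted_area (2 * real CARD('n))"
proof -
  let ?n = "real CARD('n)"
  let ?X = "\<lambda>x. (cutoff S (f x) * exp (- f x)) *\<^sub>R position_field x"
  have n: "?n > 0" by simp
  have pointwise: "divergence ?X x \<le> ?n * (8 * (cutoff (2 * ?n) (f x) * (W x * exp (- f x)))
      - cutoff S (f x) * (W x * exp (- f x)))" for x
  proof -
    have "divergence ?X x = W x * exp (- f x) *
        ((?n - 2 * f x) * cutoff S (f x) - 4 / S * max 0 (1 - f x / S) * (f x - (H x)\<^sup>2))"
      using divergence_scaleR[OF has_derivative_cutoff_exp[OF S] smooth_differentiable[OF smooth_position_field]]
      by (simp add: Df_inner_position_field divergence_position_field algebra_simps diff_divide_distrib)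
    also have "\<dots> \<le> W x * exp (- f x) * ((?n - 2 * f x) * cutoff S (f x))"
      using W_pos[of x] S H_sq_le_f[of x] by (intro mult_left_mono) auto
    also have "\<dots> \<le> W x * exp (- f x) * (?n * (8 * cutoff (2 * ?n) (f x) - cutoff S (f x)))"
    proof (intro mult_left_mono)
      show "(?n - 2 * f x) * cutoff S (f x) \<le> ?n * (8 * cutoff (2 * ?n) (f x) - cutoff S (f x))"
      proof (cases "f x \<le> ?n")
        case True
        have "(2 * ?n - 2 * f x) * cutoff S (f x) \<le> (2 * ?n) * 1"
          using True f_nonneg[of x] S cutoff_le_1 cutoff_nonneg by (intro mult_mono) auto
        also have "\<dots> \<le> ?n * (8 * cutoff (2 * ?n) (f x))"
          using quarter_le_cutoff[OF n True] by simp
        finally show ?thesis by (simp add: algebra_simps)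
      next
        case False
        then have "(2 * ?n - 2 * f x) * cutoff S (f x) \<le> 0"
          using cutoff_nonneg by (intro mult_nonpos_nonneg) auto
        moreover have "0 \<le> ?n * (8 * cutoff (2 * ?n) (f x))" using cutoff_nonneg by simp
        ultimately show ?thesis by (simp add: algebra_simps)
      qed
    qed (use W_pos[of x] in auto)
    finally show ?thesis by (simp add: algebra_simps)
  qed
  have C1: "C_k (Suc 0) (\<lambda>x. ?X x $ i)" for i
    using C_k_mult[OF C_1_cutoff_exp[OF S] smooth_imp_C_k[OF smooth_position_field]] by simp
  have div: "integrable lborel (divergence ?X)" "(LINT x|lborel. divergence ?X x) = 0"
    using integral_divergence_eq_0[OF C1 compact_cball, of 0 "2 * sqrt S"]
    by (simp_all add: cutoff_f_compact_support S)
  have int: "integrable lborel (\<lambda>x. 8 * (cutoff (2 * ?n) (f x) * (W x * exp (- f x))))"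
      "integrable lborel (\<lambda>x. cutoff S (f x) * (W x * exp (- f x)))"
    using integrable_weighted_area[of "2 * ?n"] integrable_weighted_area[OF S] by simp_all
  have "0 \<le> (LINT x|lborel. ?n * (8 * (cutoff (2 * ?n) (f x) * (W x * exp (- f x)))
      - cutoff S (f x) * (W x * exp (- f x))))"
    unfolding div(2)[symmetric]
    by (intro integral_mono div(1) pointwise integrable_mult_right Bochner_Integration.integrable_diff int)
  also have "\<dots> = ?n * (8 * weighted_area (2 * ?n) - weighted_area S)"
    using int by (simp add: weighted_area_def)
  finally show ?thesis using n by (simp add: zero_le_mult_iff)
qed

section \<open>The energy estimate and rigidity\<close>

definition energy_density where "energy_density k x = Q x (Dv k x) (Dv k x) * exp (- f x)"

lemma v_sq_le: "(v k x)\<^sup>2 \<le> (W x)\<^sup>2"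
proof -
  have "\<bar>p x $ k\<bar>\<^sup>2 \<le> (norm (p x))\<^sup>2" by (intro power_mono component_le_norm_cart) auto
  then show ?thesis by (simp add: W_sq v_def gradient_def power2_norm_eq_inner)
qed

lemma Q_diff_scaled: "Q x (a *\<^sub>R y - b *\<^sub>R z) (a *\<^sub>R y - b *\<^sub>R z)
    = a\<^sup>2 * Q x y y - 2 * a * b * Q x z y + b\<^sup>2 * Q x z z"
  using W_pos[of x]
  by (simp add: Q_def inner_diff_left inner_diff_right inner_commute field_simps power2_eq_square)

lemma continuous_energy_density: "continuous_on UNIV (energy_density k)"
proof -
  have "energy_density k = (\<lambda>x. (\<Sum>i\<in>UNIV. Dv k x $ i * dN k x $ i) * exp (- f x))"
    by (simp add: fun_eq_iff energy_density_def inner_dN[symmetric] inner_vec_def)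
  moreover have "smooth (\<lambda>x. \<Sum>i\<in>UNIV. Dv k x $ i * dN k x $ i)"
    by (intro smooth_sum smooth_mult smooth_dN) (simp add: Dv_def gradient_def smooth_partial_deriv smooth_v)
  ultimately show ?thesis
    using continuous_on_mult[OF continuous_smooth continuous_on_exp[OF continuous_on_minus[OF continuous_f]]]
    by simp
qed

text \<open>A Caccioppoli inequality. The field \<open>cutoff \<cdot> exp (-f) \<cdot> v \<cdot> dN\<close> has integral of divergence zero;
  its divergence is the cut-off energy density plus a cross term in \<open>Df\<close> and \<open>Dv\<close>. Young's inequality
  for \<open>Q\<close> absorbs half of the energy and leaves \<open>v\<^sup>2 Q(Df, Df) / S\<^sup>2\<close>. Since \<open>Q(Df, Df) \<le> f / W\<close>,
  \<open>v\<^sup>2 \<le> W\<^sup>2\<close> and \<open>f < S\<close> on the support, what is left is at most \<open>W / S\<close> up to a factor.\<close>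

lemma energy_bound:
  assumes S: "S > 0"
  shows "(LINT x|lborel. cutoff S (f x) * energy_density k x) \<le> 16 / S * weighted_area (2 * S)"
proof -
  let ?X = "\<lambda>x. ((cutoff S (f x) * exp (- f x)) * v k x) *\<^sub>R dN k x"
  have pointwise: "1 / 2 * (cutoff S (f x) * energy_density k x)
      - 8 / S * (cutoff (2 * S) (f x) * (W x * exp (- f x))) \<le> divergence ?X x" for x
  proof -
    let ?c = "max 0 (1 - f x / S)"
    let ?q = "Q x (Dv k x) (Dv k x)"
    have div: "divergence ?X x
        = exp (- f x) * (?c\<^sup>2 * ?q - 2 / S * ?c * v k x * Q x (Df x) (Dv k x))"
      using divergence_scaleR[OF has_derivative_mult[OF has_derivative_cutoff_exp[OF S]
            has_derivative_v[of k]] smooth_differentiable[OF smooth_dN[of k]]]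
      by (simp add: divergence_dN inner_dN cutoff_def algebra_simps)
    \<comment> \<open>nonnegativity of \<open>Q\<close> on a combination of \<open>Dv\<close> and \<open>Df\<close> with weights balanced for absorption\<close>
    have young: "2 / S * ?c * v k x * Q x (Df x) (Dv k x)
        \<le> 1 / 2 * (?c\<^sup>2 * ?q) + 2 / S\<^sup>2 * ((v k x)\<^sup>2 * Q x (Df x) (Df x))"
      using Q_self_nonneg[of x "?c *\<^sub>R Dv k x - (2 / S * v k x) *\<^sub>R Df x"] S
      unfolding Q_diff_scaled by (simp add: field_simps power2_eq_square)
    show ?thesis
    proof (cases "f x < S")
      case True
      have "(v k x)\<^sup>2 * Q x (Df x) (Df x) \<le> (W x)\<^sup>2 * (f x / W x)"
        using v_sq_le[of k x] Q_self_nonneg[of x "Df x"] W_pos[of x]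
        by (intro mult_mono) (auto simp: Q_Df_Df divide_right_mono)
      also have "\<dots> = f x * W x" using W_pos[of x] by (simp add: power2_eq_square)
      also have "\<dots> \<le> S * W x * 1" using True W_pos[of x] by simp
      also have "\<dots> \<le> S * W x * (4 * cutoff (2 * S) (f x))"
        using quarter_le_cutoff[OF S, of "f x"] True S W_pos[of x]
        by (intro mult_left_mono) auto
      finally have "2 / S\<^sup>2 * ((v k x)\<^sup>2 * Q x (Df x) (Df x))
          \<le> 2 / S\<^sup>2 * (S * W x * (4 * cutoff (2 * S) (f x)))"
        using S by (intro mult_left_mono) auto
      also have "\<dots> = 8 / S * (cutoff (2 * S) (f x) * W x)"
        using S by (simp add: power2_eq_square)
      finally have "exp (- f x) * (1 / 2 * (?c\<^sup>2 * ?q) - 8 / S * (cutoff (2 * S) (f x) * W x))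
          \<le> exp (- f x) * (?c\<^sup>2 * ?q - 2 / S * ?c * v k x * Q x (Df x) (Dv k x))"
        using young by (intro mult_left_mono) auto
      then show ?thesis
        unfolding div unfolding energy_density_def cutoff_def[of S] by (simp add: algebra_simps)
    next
      case False
      then have "?c = 0" using S by simp
      moreover have "0 \<le> 8 / S * (cutoff (2 * S) (f x) * (W x * exp (- f x)))"
        using S cutoff_nonneg[of "2 * S" "f x"] W_pos[of x] by simp
      ultimately show ?thesis unfolding div unfolding cutoff_def[of S] by simp
    qed
  qed
  have C1: "C_k (Suc 0) (\<lambda>x. ?X x $ i)" for i
    using C_k_mult[OF C_k_mult[OF C_1_cutoff_exp[OF S] smooth_imp_C_k[OF smooth_v[of k]]]
        smooth_imp_C_k[OF smooth_dN]] by simp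
  have div: "integrable lborel (divergence ?X)" "(LINT x|lborel. divergence ?X x) = 0"
    using integral_divergence_eq_0[OF C1 compact_cball, of 0 "2 * sqrt S"]
    by (simp_all add: cutoff_f_compact_support S)
  have int: "integrable lborel (\<lambda>x. 1 / 2 * (cutoff S (f x) * energy_density k x))"
      "integrable lborel (\<lambda>x. 8 / S * (cutoff (2 * S) (f x) * (W x * exp (- f x))))"
    using integrable_cutoff[OF S continuous_energy_density[of k]] integrable_weighted_area[of "2 * S"] S by simp_all
  have "(LINT x|lborel. 1 / 2 * (cutoff S (f x) * energy_density k x)
      - 8 / S * (cutoff (2 * S) (f x) * (W x * exp (- f x)))) \<le> 0"
    unfolding div(2)[symmetric]
    by (intro integral_mono div(1) pointwise Bochner_Integration.integrable_diff int)
  then show ?thesis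
    unfolding Bochner_Integration.integral_diff[OF int] by (simp add: weighted_area_def)
qed

text \<open>The energy cut off at a fixed \<open>S0\<close> is dominated by the energy cut off at any larger \<open>S\<close>, which is
  of order \<open>1 / S\<close>. So the former vanishes, and \<open>S0\<close> can be chosen beyond \<open>f x\<close>.\<close>

lemma energy_density_eq_0: "energy_density k x = 0"
proof -
  let ?C = "16 * (8 * weighted_area (2 * real CARD('n)))"
  define S0 where "S0 = f x + 1"
  have S0: "S0 > 0" using f_nonneg[of x] by (simp add: S0_def)
  have energy_density_nonneg: "energy_density k y \<ge> 0" for y by (simp add: energy_density_def Q_self_nonneg)
  have int: "integrable lborel (\<lambda>y. cutoff S (f y) * energy_density k y)" if "S > 0" for S
    by (rule integrable_cutoff[OF that continuous_energy_density])
  have bound: "(LINT y|lborel. cutoff S0 (f y) * energy_density k y) \<le> ?C / S" if S: "S \<ge> S0" for S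
  proof -
    have "S > 0" using S S0 by simp
    have "(LINT y|lborel. cutoff S0 (f y) * energy_density k y) \<le> (LINT y|lborel. cutoff S (f y) * energy_density k y)"
      using S0 S \<open>S > 0\<close>
      by (intro integral_mono int mult_right_mono cutoff_mono f_nonneg energy_density_nonneg) auto
    also have "\<dots> \<le> 16 / S * weighted_area (2 * S)" by (rule energy_bound[OF \<open>S > 0\<close>])
    also have "\<dots> \<le> 16 / S * (8 * weighted_area (2 * real CARD('n)))"
      using \<open>S > 0\<close> by (intro mult_left_mono weighted_area_bound) auto
    finally show ?thesis by simp
  qed
  have "((\<lambda>S. ?C / S) \<longlongrightarrow> 0) at_top"
    by (intro tendsto_divide_0[OF tendsto_const] filterlim_at_top_imp_at_infinity filterlim_ident)
  then have "(LINT y|lborel. cutoff S0 (f y) * energy_density k y) \<le> 0"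
    by (rule tendsto_lowerbound)
      (use bound in \<open>auto intro: eventually_at_top_linorderI[of S0]\<close>)
  then have "cutoff S0 (f x) * energy_density k x = 0"
    by (intro nonneg_integral_le_0_imp_eq_0[where g = "\<lambda>y. cutoff S0 (f y) * energy_density k y"] int S0
        mult_nonneg_nonneg cutoff_nonneg energy_density_nonneg continuous_on_mult continuous_on_cutoff
        continuous_energy_density continuous_f)
  moreover have "cutoff S0 (f x) > 0" by (rule cutoff_pos[OF S0]) (simp add: S0_def)
  ultimately show ?thesis by simp
qed

lemma Dv_eq_0: "Dv k x = 0"
proof -
  have "Q x (Dv k x) (Dv k x) = 0" using energy_density_eq_0[of k x] by (simp add: energy_density_def)
  then have "Dv k x \<bullet> Dv k x \<le> 0" using norm_sq_le_Q[where x = x and a = "Dv k x"] by simp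
  then show ?thesis using inner_gt_zero_iff[of "Dv k x"] by linarith
qed

lemma u_linear: "u x = p 0 \<bullet> x"
proof -
  have p_const: "p x = p 0" for x
  proof -
    have "v k x = v k 0" for k
      using has_derivative_zero_unique[of UNIV "v k" x 0] has_derivative_v[of k]
      by (simp add: Dv_eq_0)
    then show ?thesis by (simp add: vec_eq_iff gradient_def v_def)
  qed
  have "N = (\<lambda>x. N 0)"
  proof
    show "N x = N 0" for x unfolding N_def W_def p_const[of x] ..
  qed
  then have "divergence N 0 = 0" using divergence_const[of "N 0" 0] by simp
  then have u0: "u 0 = 0"
    using divergence_N[of 0] W_pos[of 0] by (simp add: H_def)
  have "((\<lambda>x. u x - p 0 \<bullet> x) has_derivative (\<lambda>h. 0)) (at x)" for x
    using has_derivative_u[of x] p_const[of x] by (auto intro!: derivative_eq_intros)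
  then have "u x - p 0 \<bullet> x = 0"
    using has_derivative_zero_unique[of UNIV "\<lambda>x. u x - p 0 \<bullet> x" x 0] u0 by simp
  then show ?thesis by simp
qed

end

theorem theorem1p1:
  fixes u :: "real ^ 'n::finite \<Rightarrow> real"
  assumes "smooth u"
    and "\<And>x. divergence (\<lambda>y. (1 / sqrt (1 + (norm (gradient u y))\<^sup>2)) *\<^sub>R gradient u y) x
           = ((\<Sum>i\<in>UNIV. x $ i * partial_deriv i u x) - u x)
               / (2 * sqrt (1 + (norm (gradient u x))\<^sup>2))"
  shows "\<exists>a :: real ^ 'n. \<forall>x. u x = (\<Sum>i\<in>UNIV. a $ i * x $ i)"
proof -
  interpret self_shrinker_graph u by unfold_locales (fact assms)+
  show ?thesis using u_linear by (auto simp: inner_vec_def)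
qed

end
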